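(* Let $X$ be a cocompact generalized Baumslag--Solitar tree with group $G$. If every edge stabilizer is a proper subgroup of its neighboring vertex stabilizers (that is, $G_e\subsetneq G_v$ for every edge $e$ and each endpoint $v$ of $e$), then $X$ is unfolded.
   Context: A $G$-tree is a simplicial tree with an action of $G$ by automorphisms without inversions; it is cocompact if its quotient graph is finite. A generalized Baumslag--Solitar tree is a $G$-tree all of whose vertex and edge stabilizers are infinite cyclic. A splitting of $G$ over $C$ is a graph of groups decomposition $G=A*_C B$ with $A\neq C\neq B$, or $G=A*_C$ (HNN, no restriction on $C$); equivalently one considers its Bass--Serre tree. A fold of a $G$-tree: choose edges $e,f$ with the same initial vertex, and identify $\gamma e$ with $\gamma f$ for every $\gamma\in G$; the result is again a tree with a $G$-action, and the fold is the quotient map. A splitting $\mathcal{A}_1$ is unfolded if there do not exist a splitting $\mathcal{A}_2$ and a non-trivial fold $\mathcal{A}_2\to\mathcal{A}_1$ (between the Bass--Serre trees). Such a fold involves only $G$-trees having a single edge orbit, and therefore induces an isomorphism of quotient graphs. A graph of groups, or the corresponding $G$-tree $X$, is unfolded if every splitting arising from its edges is unfolded; the splitting arising from an edge $e$ of $X$ is the one whose Bass--Serre tree is obtained from $X$ by collapsing each connected component of $X - Ge$ to a vertex. *)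

theory Defs
  imports "HOL-Algebra.Group_Action" "HOL-Algebra.Elementary_Groups"
begin

section \<open>Simplicial trees with a group action\<close>

text \<open>
  Trees have neither loops nor multiple edges, so an edge is the set of its two endpoints, an
  oriented edge is a pair of adjacent vertices, and an action on the vertices determines the action
  on the edges.
\<close>

definition adj :: "'v set set \<Rightarrow> ('v \<times> 'v) set" where
  "adj E = {(x, y). {x, y} \<in> E}"

definition simplicial_tree :: "'v set \<Rightarrow> 'v set set \<Rightarrow> bool" where
  "simplicial_tree V E \<longleftrightarrow>
     V \<noteq> {} \<and>
     (\<forall>e\<in>E. e \<subseteq> V \<and> card e = 2) \<and>
     (\<forall>x\<in>V. \<forall>y\<in>V. (x, y) \<in> (adj E)\<^sup>*) \<and>
     \<not> (\<exists>p. 3 \<le> length p \<and> distinct p \<and>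
            successively (\<lambda>x y. (x, y) \<in> adj E) p \<and> (last p, hd p) \<in> adj E)"

record ('g, 'v) gtree =
  verts :: "'v set"
  edges :: "'v set set"
  act   :: "'g \<Rightarrow> 'v \<Rightarrow> 'v"

definition edge_act :: "('g, 'v) gtree \<Rightarrow> 'g \<Rightarrow> 'v set \<Rightarrow> 'v set" where
  "edge_act X g e = act X g ` e"

definition is_gtree :: "('g, 'b) monoid_scheme \<Rightarrow> ('g, 'v) gtree \<Rightarrow> bool" where
  "is_gtree G X \<longleftrightarrow>
     simplicial_tree (verts X) (edges X) \<and>
     group_action G (verts X) (act X) \<and>
     (\<forall>g\<in>carrier G. \<forall>e\<in>edges X. edge_act X g e \<in> edges X) \<and>
     (\<forall>g\<in>carrier G. \<forall>u v. {u, v} \<in> edges X \<longrightarrow> \<not> (act X g u = v \<and> act X g v = u))"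

definition vertex_stab :: "('g, 'b) monoid_scheme \<Rightarrow> ('g, 'v) gtree \<Rightarrow> 'v \<Rightarrow> 'g set" where
  "vertex_stab G X v = stabilizer G (act X) v"

definition edge_stab :: "('g, 'b) monoid_scheme \<Rightarrow> ('g, 'v) gtree \<Rightarrow> 'v set \<Rightarrow> 'g set" where
  "edge_stab G X e = stabilizer G (edge_act X) e"

definition cocompact :: "('g, 'b) monoid_scheme \<Rightarrow> ('g, 'v) gtree \<Rightarrow> bool" where
  "cocompact G X \<longleftrightarrow>
     finite (orbits G (verts X) (act X)) \<and> finite (orbits G (edges X) (edge_act X))"

definition infinite_cyclic :: "('g, 'b) monoid_scheme \<Rightarrow> 'g set \<Rightarrow> bool" where
  "infinite_cyclic G H \<longleftrightarrow>
     subgroup H G \<and> cyclic_group (G\<lparr>carrier := H\<rparr>) \<and> infinite H"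

definition gbs_tree :: "('g, 'b) monoid_scheme \<Rightarrow> ('g, 'v) gtree \<Rightarrow> bool" where
  "gbs_tree G X \<longleftrightarrow>
     is_gtree G X \<and>
     (\<forall>v\<in>verts X. infinite_cyclic G (vertex_stab G X v)) \<and>
     (\<forall>e\<in>edges X. infinite_cyclic G (edge_stab G X e))"

text \<open>Equivariant isomorphism of trees.\<close>

definition gtree_iso ::
  "('g, 'b) monoid_scheme \<Rightarrow> ('g, 'v) gtree \<Rightarrow> ('g, 'w) gtree \<Rightarrow> bool" where
  "gtree_iso G X Y \<longleftrightarrow>
     (\<exists>h. bij_betw h (verts X) (verts Y) \<and>
          edges Y = (`) h ` edges X \<and>
          (\<forall>g\<in>carrier G. \<forall>x\<in>verts X. h (act X g x) = act Y g (h x)))"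


section \<open>Splittings\<close>

text \<open>
  A splitting of the group is represented by its Bass--Serre tree, a tree with a single orbit of
  (unoriented) edges. If the two endpoints of an edge lie in the same orbit, the quotient graph is
  a loop and the group is an HNN extension. Otherwise the quotient graph is a segment and the group
  is the amalgam of the two endpoint stabilizers over the edge stabilizer.
\<close>

definition is_splitting :: "('g, 'b) monoid_scheme \<Rightarrow> ('g, 'v) gtree \<Rightarrow> bool" where
  "is_splitting G T \<longleftrightarrow>
     is_gtree G T \<and>
     (\<exists>u v. {u, v} \<in> edges T \<and>
        edges T = orbit G (edge_act T) {u, v} \<and>
        (v \<in> orbit G (act T) u \<or>
         vertex_stab G T u \<noteq> edge_stab G T {u, v} \<and>
         vertex_stab G T v \<noteq> edge_stab G T {u, v}))"


section \<open>Folds and collapses\<close>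

text \<open>
  The quotient of a tree by an invariant equivalence relation on its vertices. Edges whose two
  endpoints become identified disappear.
\<close>

definition quotient_gtree :: "('g, 'v) gtree \<Rightarrow> ('v \<times> 'v) set \<Rightarrow> ('g, 'v set) gtree" where
  "quotient_gtree X R =
     \<lparr> verts = verts X // R,
       edges = {{R `` {x}, R `` {y}} | x y. {x, y} \<in> edges X \<and> (x, y) \<notin> R},
       act = (\<lambda>g. \<lambda>K \<in> verts X // R. act X g ` K) \<rparr>"

text \<open>
  The fold of the oriented edges \<open>(v, w)\<close> and \<open>(v, u)\<close> identifies \<open>(\<gamma> v, \<gamma> w)\<close> with
  \<open>(\<gamma> v, \<gamma> u)\<close> for every \<open>\<gamma>\<close>. On vertices this is the equivalence relation generated by
  \<open>\<gamma> w \<sim> \<gamma> u\<close>. Identified vertices are at even distance in the tree, so no edge disappears.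
\<close>

definition fold_rel ::
  "('g, 'b) monoid_scheme \<Rightarrow> ('g, 'v) gtree \<Rightarrow> 'v \<Rightarrow> 'v \<Rightarrow> ('v \<times> 'v) set" where
  "fold_rel G X w u =
     (let r = {(act X \<gamma> w, act X \<gamma> u) | \<gamma>. \<gamma> \<in> carrier G}
      in (r \<union> r\<inverse>)\<^sup>* \<inter> verts X \<times> verts X)"

text \<open>The fold is trivial if the two edges that are folded together coincide.\<close>

definition nontrivial_fold ::
  "('g, 'b) monoid_scheme \<Rightarrow> ('g, 'w) gtree \<Rightarrow> ('g, 'v) gtree \<Rightarrow> bool" where
  "nontrivial_fold G S T \<longleftrightarrow>
     (\<exists>v w u. {v, w} \<in> edges S \<and> {v, u} \<in> edges S \<and> w \<noteq> u \<and>
        gtree_iso G (quotient_gtree S (fold_rel G S w u)) T)"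

text \<open>Collapse every connected component of \<open>X - G e\<close> to a vertex.\<close>

definition collapse ::
  "('g, 'b) monoid_scheme \<Rightarrow> ('g, 'v) gtree \<Rightarrow> 'v set \<Rightarrow> ('g, 'v set) gtree" where
  "collapse G X e =
     quotient_gtree X
       ((adj (edges X - orbit G (edge_act X) e))\<^sup>* \<inter> verts X \<times> verts X)"


section \<open>Unfolded trees\<close>

text \<open>
  A quantifier inside a formula cannot range over types, so the vertex type \<open>'w\<close> of the splittings
  that may be folded is an argument. Being unfolded in the usual sense means that the following
  predicates hold for every type \<open>'w\<close>.
\<close>

definition unfolded_splitting ::
  "'w itself \<Rightarrow> ('g, 'b) monoid_scheme \<Rightarrow> ('g, 'v) gtree \<Rightarrow> bool" where
  "unfolded_splitting W G T \<longleftrightarrow>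
     \<not> (\<exists>S :: ('g, 'w) gtree. is_splitting G S \<and> nontrivial_fold G S T)"

definition unfolded ::
  "'w itself \<Rightarrow> ('g, 'b) monoid_scheme \<Rightarrow> ('g, 'v) gtree \<Rightarrow> bool" where
  "unfolded W G X \<longleftrightarrow>
     (\<forall>e\<in>edges X. is_splitting G (collapse G X e) \<longrightarrow>
        unfolded_splitting W G (collapse G X e))"

end

theory Submission
  imports Defs
begin

text \<open>
  Let \<open>S\<close> be a splitting whose fold along two edges \<open>{v, w}\<close> and \<open>{v, u}\<close> is the splitting \<open>T\<close>
  obtained from \<open>X\<close> by collapsing everything except the orbit of an edge \<open>e\<close>. Write \<open>\<sim>\<close> for the
  relation on the vertices of \<open>S\<close> generated by the fold. As \<open>S\<close> has one orbit of edges, some \<open>g\<close>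
  carries \<open>{v, w}\<close> to \<open>{v, u}\<close>.

  If \<open>g\<close> exchanges the roles of the endpoints (\<open>g v = u\<close> and \<open>g w = v\<close>), then, since \<open>u \<sim> w\<close>, it
  inverts the image of \<open>{v, w}\<close> in \<open>T\<close>, which is impossible in a tree without inversions.

  Otherwise \<open>g v = v\<close> and \<open>g w = u \<noteq> w\<close>, so that \<open>g\<close> fixes the folded edge although it moves
  \<open>{v, w}\<close>. The folded edge comes from an edge \<open>{x, y}\<close> of \<open>X\<close>, with \<open>x\<close> in the component
  corresponding to the image of \<open>w\<close>, and the stabilizer of the folded edge lies in \<open>G\<^sub>x\<^sub>y\<close>
  (\<open>component_stab_le_edge_stab\<close>). By hypothesis there is \<open>t\<close> in \<open>G\<^sub>x\<close> but not in \<open>G\<^sub>x\<^sub>y\<close>. This \<open>t\<close>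
  preserves the image of \<open>w\<close> but not that of \<open>v\<close>, so \<open>t v \<noteq> v\<close>. Everything in \<open>G\<^sub>x\<close> commutes, because
  \<open>G\<^sub>x\<close> is cyclic; hence \<open>g\<close> fixes \<open>t v\<close> as well as \<open>v\<close>, and so the first edge of the geodesic of
  \<open>S\<close> between them. Now \<open>v\<close> and \<open>t v\<close> both have neighbours in the class of \<open>w\<close>, and the vertices of
  that class are strung together by translates of the folded pair of edges; so the geodesic starts
  along a translate \<open>k {v, w}\<close> with \<open>k v = v\<close> and \<open>k w \<sim> w\<close> (\<open>forward_first_step_translate\<close>). This
  \<open>k\<close> fixes the folded edge, so it also lies in \<open>G\<^sub>x\<close> and commutes with \<open>g\<close>. As \<open>g\<close> fixes \<open>k w\<close>, it
  fixes \<open>w\<close>, a contradiction (\<open>commuting_element_fixes_v\<close>).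
\<close>

section \<open>Paths in simplicial trees\<close>

lemma rtrancl_imp_distinct_path:
  assumes "(x, y) \<in> r\<^sup>*"
  shows "\<exists>p. p \<noteq> [] \<and> hd p = x \<and> last p = y \<and> distinct p \<and> successively (\<lambda>a b. (a, b) \<in> r) p"
  using assms
proof (induction rule: converse_rtrancl_induct)
  case base
  show ?case by (intro exI[of _ "[y]"]) auto
next
  case (step x z)
  then obtain p where p: "p \<noteq> []" "hd p = z" "last p = y" "distinct p"
    "successively (\<lambda>a b. (a, b) \<in> r) p" by blast
  show ?case
  proof (cases "x \<in> set p")
    case True
    then obtain p1 p2 where "p = p1 @ x # p2" by (meson split_list)
    with p show ?thesis
      by (intro exI[of _ "x # p2"]) (auto simp: successively_append_iff)
  next
    case False
    with p step show ?thesis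
      by (intro exI[of _ "x # p"]) (auto simp: successively_Cons)
  qed
qed

lemma sym_adj: "sym (adj E)"
  by (auto simp: sym_def adj_def insert_commute)

text \<open>
  A walk from \<open>x\<close> to \<open>y\<close> avoiding the edge \<open>{x, y}\<close> shortens to a walk without repetitions, which
  that edge closes up to a circuit.
\<close>

lemma tree_edge_separates:
  assumes "simplicial_tree V E" "{x, y} \<in> E"
  shows "(x, y) \<notin> (adj (E - {{x, y}}))\<^sup>*"
proof
  assume "(x, y) \<in> (adj (E - {{x, y}}))\<^sup>*"
  from rtrancl_imp_distinct_path[OF this] obtain p where p: "p \<noteq> []" "hd p = x" "last p = y"
    "distinct p" "successively (\<lambda>a b. (a, b) \<in> adj (E - {{x, y}})) p" by blast
  have "card {x, y} = 2" using assms unfolding simplicial_tree_def by blast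
  then have "x \<noteq> y" by auto
  with p have "3 \<le> length p"
    by (cases p; cases "tl p"; cases "tl (tl p)") (auto simp: adj_def)
  moreover have "successively (\<lambda>a b. (a, b) \<in> adj E) p"
    using p(5) by (rule successively_mono) (auto simp: adj_def)
  moreover have "(last p, hd p) \<in> adj E"
    using p assms(2) by (simp add: adj_def insert_commute)
  ultimately show False using assms(1) p(4) unfolding simplicial_tree_def by blast
qed

text \<open>
  The statement \<open>(y, z) \<in> (adj_off E x)\<^sup>*\<close> for a neighbour \<open>y\<close> of \<open>x\<close> expresses, without naming a
  path, that the geodesic from \<open>x\<close> to \<open>z\<close> starts with the edge \<open>{x, y}\<close>.
\<close>

definition adj_off :: "'v set set \<Rightarrow> 'v \<Rightarrow> ('v \<times> 'v) set" where
  "adj_off E x = {(a, b) \<in> adj E. a \<noteq> x \<and> b \<noteq> x}"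

lemma sym_adj_off: "sym (adj_off E x)"
  using sym_adj[of E] by (auto simp: sym_def adj_off_def)

text \<open>
  Two different neighbours of \<open>x\<close>, both joined to \<open>z\<close> away from \<open>x\<close>, would be joined to each other
  away from \<open>x\<close>, so that \<open>{x, y1}\<close> would not separate its endpoints.
\<close>

lemma tree_first_step_unique:
  assumes T: "simplicial_tree V E"
    and "(x, y1) \<in> adj E" "(x, y2) \<in> adj E"
    and "(y1, z) \<in> (adj_off E x)\<^sup>*" "(y2, z) \<in> (adj_off E x)\<^sup>*"
  shows "y1 = y2"
proof (rule ccontr)
  assume ne: "y1 \<noteq> y2"
  have "(z, y2) \<in> (adj_off E x)\<^sup>*"
    using assms(5) sym_adj_off by (metis sym_rtrancl symD)
  then have "(y1, y2) \<in> (adj_off E x)\<^sup>*"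
    using assms(4) by (rule rtrancl_trans[rotated])
  moreover have "adj_off E x \<subseteq> adj (E - {{x, y1}})"
    by (auto simp: adj_off_def adj_def doubleton_eq_iff)
  ultimately have "(y1, y2) \<in> (adj (E - {{x, y1}}))\<^sup>*"
    using rtrancl_mono by blast
  moreover have "(y2, x) \<in> adj (E - {{x, y1}})"
    using assms(3) ne by (auto simp: adj_def doubleton_eq_iff insert_commute)
  ultimately have "(y1, x) \<in> (adj (E - {{y1, x}}))\<^sup>*"
    by (simp add: insert_commute)
  moreover have "{y1, x} \<in> E" using assms(2) by (simp add: adj_def insert_commute)
  ultimately show False using tree_edge_separates[OF T] by blast
qed

section \<open>Invariant quotients of a tree with a group action\<close>

locale group_tree =
  fixes G :: "('g, 'b) monoid_scheme" and X :: "('g, 'v) gtree"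
  assumes gtree: "is_gtree G X"
begin

lemma tree: "simplicial_tree (verts X) (edges X)"
  using gtree by (simp add: is_gtree_def)

lemma action: "group_action G (verts X) (act X)"
  using gtree by (simp add: is_gtree_def)

lemma is_group: "group G"
  using action by (simp add: group_action_def group_hom_def)

lemma edge_verts: "{x, y} \<in> edges X \<Longrightarrow> x \<in> verts X \<and> y \<in> verts X \<and> x \<noteq> y"
proof -
  assume "{x, y} \<in> edges X"
  then have "{x, y} \<subseteq> verts X" "card {x, y} = 2"
    using tree unfolding simplicial_tree_def by blast+
  then show ?thesis by auto
qed

lemma act_closed: "g \<in> carrier G \<Longrightarrow> x \<in> verts X \<Longrightarrow> act X g x \<in> verts X"
  using group_action.element_image[OF action] by blast

lemma act_mult:
  "g \<in> carrier G \<Longrightarrow> h \<in> carrier G \<Longrightarrow> x \<in> verts X \<Longrightarrow>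
     act X (g \<otimes>\<^bsub>G\<^esub> h) x = act X g (act X h x)"
  using group_action.composition_rule[OF action] by blast

lemma act_one: "x \<in> verts X \<Longrightarrow> act X \<one>\<^bsub>G\<^esub> x = x"
  using group_action.id_eq_one[OF action] by (metis restrict_apply')

lemma act_inv: "g \<in> carrier G \<Longrightarrow> x \<in> verts X \<Longrightarrow> act X (inv\<^bsub>G\<^esub> g) (act X g x) = x"
  using group_action.orbit_sym_aux[OF action] by blast

lemma act_inj:
  "g \<in> carrier G \<Longrightarrow> x \<in> verts X \<Longrightarrow> y \<in> verts X \<Longrightarrow> act X g x = act X g y \<Longrightarrow> x = y"
  by (metis act_inv)

lemma act_edge: "g \<in> carrier G \<Longrightarrow> {x, y} \<in> edges X \<Longrightarrow> {act X g x, act X g y} \<in> edges X"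
  using gtree unfolding is_gtree_def edge_act_def by (metis image_empty image_insert)

lemma no_inversion:
  "g \<in> carrier G \<Longrightarrow> {x, y} \<in> edges X \<Longrightarrow> act X g x = y \<Longrightarrow> act X g y \<noteq> x"
  using gtree by (auto simp: is_gtree_def)

lemma act_adj_off:
  assumes g: "g \<in> carrier G" and x: "x \<in> verts X" and "(a, b) \<in> (adj_off (edges X) x)\<^sup>*"
  shows "(act X g a, act X g b) \<in> (adj_off (edges X) (act X g x))\<^sup>*"
  using assms(3)
proof (induction rule: rtrancl_induct)
  case (step b c)
  have "(act X g b, act X g c) \<in> adj_off (edges X) (act X g x)"
    using step(2) act_edge[OF g] act_inj[OF g] edge_verts x
    by (auto simp: adj_off_def adj_def)
  with step show ?case by (metis rtrancl.rtrancl_into_rtrancl)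
qed auto

text \<open>
  In a tree with one orbit of unoriented edges, the translate may reverse the order of the endpoints;
  this is why the conclusion is an equation between sets.
\<close>

lemma orbit_edges_translate:
  assumes "edges X = orbit G (edge_act X) e0" "e0 \<in> edges X"
    and "{a, b} \<in> edges X" "f \<in> edges X"
  obtains k where "k \<in> carrier G" "f = {act X k a, act X k b}"
proof -
  from assms(1,3) obtain g where g: "g \<in> carrier G" "{a, b} = act X g ` e0"
    by (auto simp: orbit_def edge_act_def)
  from assms(1,4) obtain h where h: "h \<in> carrier G" "f = act X h ` e0"
    by (auto simp: orbit_def edge_act_def)
  interpret G: group G by (rule is_group)
  have "e0 \<subseteq> verts X"
    using assms(2) tree by (auto simp: simplicial_tree_def)
  have "act X (inv\<^bsub>G\<^esub> g) ` {a, b} = e0"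
    unfolding g(2) using act_inv[OF g(1)] \<open>e0 \<subseteq> verts X\<close> by (force simp: image_image)
  moreover have "act X (h \<otimes>\<^bsub>G\<^esub> inv\<^bsub>G\<^esub> g) y = act X h (act X (inv\<^bsub>G\<^esub> g) y)" if "y \<in> {a, b}" for y
    using act_mult[OF h(1) group.inv_closed[OF is_group g(1)]] that edge_verts[OF assms(3)]
    by blast
  ultimately have "f = {act X (h \<otimes>\<^bsub>G\<^esub> inv\<^bsub>G\<^esub> g) a, act X (h \<otimes>\<^bsub>G\<^esub> inv\<^bsub>G\<^esub> g) b}"
    using h(2) by auto
  with g h show thesis by (intro that[of "h \<otimes>\<^bsub>G\<^esub> inv\<^bsub>G\<^esub> g"]) auto
qed

definition invariant_equiv :: "('v \<times> 'v) set \<Rightarrow> bool" where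
  "invariant_equiv R \<longleftrightarrow> equiv (verts X) R \<and>
     (\<forall>g\<in>carrier G. \<forall>(a, b)\<in>R. (act X g a, act X g b) \<in> R)"

lemma invariant_equiv_rtrancl:
  assumes "sym s" and inv: "\<And>g a b. g \<in> carrier G \<Longrightarrow> (a, b) \<in> s \<Longrightarrow> (act X g a, act X g b) \<in> s"
  shows "invariant_equiv (s\<^sup>* \<inter> verts X \<times> verts X)"
proof -
  have "sym (s\<^sup>*)" using assms(1) by (rule sym_rtrancl)
  then have "equiv (verts X) (s\<^sup>* \<inter> verts X \<times> verts X)"
    unfolding equiv_def by (auto simp: refl_on_def sym_def trans_def intro: rtrancl_trans)
  moreover have "(act X g a, act X g b) \<in> s\<^sup>*" if "g \<in> carrier G" "(a, b) \<in> s\<^sup>*" for g a b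
    using that(2)
    by (induction rule: rtrancl_induct) (auto intro: rtrancl.rtrancl_into_rtrancl inv that(1))
  ultimately show ?thesis
    by (auto simp: invariant_equiv_def act_closed)
qed

context
  fixes R assumes R: "invariant_equiv R"
begin

lemma invariant_equiv_equiv: "equiv (verts X) R"
  using R by (simp add: invariant_equiv_def)

lemma invariant_equiv_act: "g \<in> carrier G \<Longrightarrow> (a, b) \<in> R \<Longrightarrow> (act X g a, act X g b) \<in> R"
  using R by (auto simp: invariant_equiv_def)

lemma invariant_equiv_sym: "(a, b) \<in> R \<Longrightarrow> (b, a) \<in> R"
  using invariant_equiv_equiv by (meson equivE symD)

lemma class_eq_iff:
  "a \<in> verts X \<Longrightarrow> b \<in> verts X \<Longrightarrow> R `` {a} = R `` {b} \<longleftrightarrow> (a, b) \<in> R"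
  by (rule eq_equiv_class_iff[OF invariant_equiv_equiv])

lemma quotient_act:
  assumes g: "g \<in> carrier G" and x: "x \<in> verts X"
  shows "act (quotient_gtree X R) g (R `` {x}) = R `` {act X g x}"
proof -
  have "act X g ` (R `` {x}) = R `` {act X g x}"
  proof (intro equalityI subsetI)
    fix y assume "y \<in> act X g ` (R `` {x})"
    then show "y \<in> R `` {act X g x}" using invariant_equiv_act[OF g] by auto
  next
    fix y assume "y \<in> R `` {act X g x}"
    then have y: "(act X g x, y) \<in> R" by simp
    have g': "inv\<^bsub>G\<^esub> g \<in> carrier G" using group.inv_closed[OF is_group g] .
    have yV: "y \<in> verts X" using y invariant_equiv_equiv by (auto simp: equiv_def)
    have "(x, act X (inv\<^bsub>G\<^esub> g) y) \<in> R"
      using invariant_equiv_act[OF g' y] act_inv[OF g x] by simp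
    moreover have "act X g (act X (inv\<^bsub>G\<^esub> g) y) = y"
      using act_inv[OF g' yV] group.inv_inv[OF is_group g] by simp
    ultimately show "y \<in> act X g ` (R `` {x})" by (metis Image_singleton_iff imageI)
  qed
  moreover have "R `` {x} \<in> verts X // R" using x by (rule quotientI)
  ultimately show ?thesis by (simp add: quotient_gtree_def)
qed

end

end

section \<open>Collapsing onto one edge orbit\<close>

context group_tree
begin

definition component_rel :: "'v set \<Rightarrow> ('v \<times> 'v) set" where
  "component_rel e = (adj (edges X - orbit G (edge_act X) e))\<^sup>* \<inter> verts X \<times> verts X"

lemma act_orbit_iff:
  assumes e: "e \<subseteq> verts X" and g: "g \<in> carrier G" and f: "f \<subseteq> verts X"
  shows "act X g ` f \<in> orbit G (edge_act X) e \<longleftrightarrow> f \<in> orbit G (edge_act X) e"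
proof -
  interpret G: group G by (rule is_group)
  have comp: "act X (h \<otimes>\<^bsub>G\<^esub> k) ` e = act X h ` act X k ` e"
    if "h \<in> carrier G" "k \<in> carrier G" for h k
    using act_mult[OF that] e by (force simp: image_image)
  have inv_image: "act X (inv\<^bsub>G\<^esub> g) ` act X g ` f = f"
    using act_inv[OF g] f by (force simp: image_image)
  show ?thesis
  proof
    assume "act X g ` f \<in> orbit G (edge_act X) e"
    then obtain h where h: "h \<in> carrier G" "act X g ` f = act X h ` e"
      by (auto simp: orbit_def edge_act_def)
    then have "f = act X (inv\<^bsub>G\<^esub> g \<otimes>\<^bsub>G\<^esub> h) ` e" using inv_image comp g by simp
    then show "f \<in> orbit G (edge_act X) e" using g h by (auto simp: orbit_def edge_act_def)
  next
    assume "f \<in> orbit G (edge_act X) e"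
    then obtain h where h: "h \<in> carrier G" "f = act X h ` e"
      by (auto simp: orbit_def edge_act_def)
    then have "act X g ` f = act X (g \<otimes>\<^bsub>G\<^esub> h) ` e" using comp g by simp
    then show "act X g ` f \<in> orbit G (edge_act X) e"
      using g h by (auto simp: orbit_def edge_act_def)
  qed
qed

lemma component_rel_invariant:
  assumes "e \<in> edges X"
  shows "invariant_equiv (component_rel e)"
  unfolding component_rel_def
proof (rule invariant_equiv_rtrancl[OF sym_adj])
  fix g a b assume g: "g \<in> carrier G" and ab: "(a, b) \<in> adj (edges X - orbit G (edge_act X) e)"
  have "e \<subseteq> verts X" using assms tree by (auto simp: simplicial_tree_def)
  then show "(act X g a, act X g b) \<in> adj (edges X - orbit G (edge_act X) e)"
    using act_orbit_iff[OF _ g, of e "{a, b}"] act_edge[OF g] ab edge_verts[of a b]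
    by (auto simp: adj_def)
qed

lemma component_rel_edge_in_orbit:
  assumes "{x, y} \<in> edges X" "(x, y) \<notin> component_rel e"
  shows "{x, y} \<in> orbit G (edge_act X) e"
  using assms edge_verts[OF assms(1)] by (auto simp: component_rel_def adj_def)

text \<open>
  Collapsing does not enlarge the stabilizer of a surviving edge: two different edges of the orbit
  of \<open>e\<close> between the same two components would close up to a circuit, because the components are
  connected without using that orbit.
\<close>

lemma component_stab_le_edge_stab:
  assumes e: "e \<in> edges X" and xy: "{x, y} \<in> edges X" "(x, y) \<notin> component_rel e"
    and g: "g \<in> carrier G"
    and gx: "(x, act X g x) \<in> component_rel e" and gy: "(y, act X g y) \<in> component_rel e"
  shows "g \<in> edge_stab G X {x, y}"
proof (rule ccontr)
  assume "g \<notin> edge_stab G X {x, y}"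
  then have ne: "{act X g x, act X g y} \<noteq> {x, y}"
    using g by (auto simp: edge_stab_def stabilizer_def edge_act_def)
  let ?A = "adj (edges X - {{x, y}})"
  have "{x, y} \<in> orbit G (edge_act X) e" by (rule component_rel_edge_in_orbit[OF xy])
  then have sub: "(adj (edges X - orbit G (edge_act X) e))\<^sup>* \<subseteq> ?A\<^sup>*"
    by (intro rtrancl_mono) (auto simp: adj_def)
  have "(x, act X g x) \<in> ?A\<^sup>*" using gx sub by (auto simp: component_rel_def)
  also have "(act X g x, act X g y) \<in> ?A" using act_edge[OF g xy(1)] ne by (auto simp: adj_def)
  also have "(act X g y, y) \<in> ?A\<^sup>*"
    using invariant_equiv_sym[OF component_rel_invariant[OF e] gy] sub
    by (auto simp: component_rel_def)
  finally show False using tree_edge_separates[OF tree xy(1)] by simp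
qed

end

section \<open>Folding two edges in the same orbit\<close>

context group_tree
begin

lemma fold_rel_invariant:
  assumes "w \<in> verts X" "u \<in> verts X"
  shows "invariant_equiv (fold_rel G X w u)"
proof -
  interpret G: group G by (rule is_group)
  let ?r = "{(act X \<gamma> w, act X \<gamma> u) |\<gamma>. \<gamma> \<in> carrier G}"
  have r: "(act X g a, act X g b) \<in> ?r" if "g \<in> carrier G" "(a, b) \<in> ?r" for g a b
  proof -
    from that(2) obtain h where "h \<in> carrier G" "a = act X h w" "b = act X h u" by blast
    then show ?thesis using that(1) act_mult[of g h] assms
      by (auto intro!: exI[of _ "g \<otimes>\<^bsub>G\<^esub> h"])
  qed
  have "sym (?r \<union> ?r\<inverse>)" by (rule sym_Un_converse)
  then show ?thesis unfolding fold_rel_def Let_def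
    by (rule invariant_equiv_rtrancl) (use r in blast)
qed

lemma fold_rel_pair:
  assumes "w \<in> verts X" "u \<in> verts X"
  shows "(w, u) \<in> fold_rel G X w u"
proof -
  show ?thesis using assms act_one[of w] act_one[of u] group.is_monoid[OF is_group, THEN monoid.one_closed]
    unfolding fold_rel_def Let_def
    by (auto intro!: r_into_rtrancl exI[of _ "\<one>\<^bsub>G\<^esub>"])
qed

end

text \<open>
  The fold of \<open>(v, w)\<close> with its translate \<open>(v, g w)\<close> by an element of the stabilizer of \<open>v\<close>, under the
  condition that the folded edge does not disappear in the quotient.
\<close>

locale edge_fold = group_tree G X
  for G :: "('g, 'b) monoid_scheme" and X :: "('g, 'v) gtree" +
  fixes v w :: 'v and g :: 'g
  assumes edge: "{v, w} \<in> edges X"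
    and g: "g \<in> carrier G" "act X g v = v" "act X g w \<noteq> w"
    and survives: "(v, w) \<notin> fold_rel G X w (act X g w)"
begin

abbreviation R where "R \<equiv> fold_rel G X w (act X g w)"

lemma v_vert: "v \<in> verts X" and w_vert: "w \<in> verts X"
  using edge_verts[OF edge] by auto

lemma R_invariant: "invariant_equiv R"
  using w_vert g by (intro fold_rel_invariant act_closed)

lemmas R_sym = invariant_equiv_sym[OF R_invariant]

definition arrow :: "('v \<times> 'v) set" where
  "arrow = {(act X \<gamma> v, act X \<gamma> w) | \<gamma>. \<gamma> \<in> carrier G}"

lemma arrow_adj: "(a, b) \<in> arrow \<Longrightarrow> (a, b) \<in> adj (edges X) \<and> (b, a) \<in> adj (edges X)"
  using act_edge[OF _ edge] by (auto simp: arrow_def adj_def insert_commute)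

text \<open>
  Both \<open>(v, w)\<close> and \<open>(v, g w)\<close> are arrows. So each generating step of the fold relation goes against
  an arrow from \<open>y\<close> to some \<open>c\<close> and along another one from \<open>c\<close> to \<open>z\<close>, and a whole class is
  traversed by zigzags in the tree of this form.
\<close>

lemma R_induct [consumes 1, case_names base step]:
  assumes "(a, z) \<in> R" "P a"
    and "\<And>y z c. (a, y) \<in> R \<Longrightarrow> (a, z) \<in> R \<Longrightarrow> P y \<Longrightarrow> (c, y) \<in> arrow \<Longrightarrow> (c, z) \<in> arrow \<Longrightarrow> P z"
  shows "P z"
proof -
  interpret G: group G by (rule is_group)
  let ?r = "{(act X \<gamma> w, act X \<gamma> (act X g w)) |\<gamma>. \<gamma> \<in> carrier G}"
  have *: "\<exists>c. (c, y) \<in> arrow \<and> (c, z) \<in> arrow" if r: "(y, z) \<in> ?r" for y z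
  proof -
    from r obtain h where h: "h \<in> carrier G" "y = act X h w" "z = act X h (act X g w)" by blast
    have "(act X h v, y) \<in> arrow" using h by (auto simp: arrow_def)
    moreover have "act X (h \<otimes>\<^bsub>G\<^esub> g) v = act X h v" "act X (h \<otimes>\<^bsub>G\<^esub> g) w = z"
      using h g act_mult[of h g] v_vert w_vert by auto
    then have "(act X h v, z) \<in> arrow"
      using h g unfolding arrow_def by (auto intro!: exI[of _ "h \<otimes>\<^bsub>G\<^esub> g"])
    ultimately show ?thesis by blast
  qed
  have a: "a \<in> verts X" and "(a, z) \<in> (?r \<union> ?r\<inverse>)\<^sup>*"
    using assms(1) by (auto simp: fold_rel_def Let_def)
  from this(2) have "(a, z) \<in> R \<and> P z"
  proof (induction rule: rtrancl_induct)
    case base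
    then show ?case using a assms(2) invariant_equiv_equiv[OF R_invariant]
      by (auto simp: equiv_def refl_on_def)
  next
    case (step y z)
    from step(2) * obtain c where c: "(c, y) \<in> arrow" "(c, z) \<in> arrow" by blast
    then have "z \<in> verts X" using arrow_adj edge_verts by (auto simp: adj_def)
    then have "(a, z) \<in> R"
      using a step(1,2) unfolding fold_rel_def Let_def
      by (blast intro: rtrancl.rtrancl_into_rtrancl)
    with step.IH assms(3) c show ?case by blast
  qed
  then show ?thesis ..
qed

lemma adj_off_extend:
  assumes "(a, y) \<in> (adj_off (edges X) x)\<^sup>*" "(c, y) \<in> arrow" "(c, z) \<in> arrow"
    "c \<noteq> x" "y \<noteq> x" "z \<noteq> x"
  shows "(a, z) \<in> (adj_off (edges X) x)\<^sup>*"
proof -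
  have "(y, c) \<in> adj_off (edges X) x" "(c, z) \<in> adj_off (edges X) x"
    using assms arrow_adj by (auto simp: adj_off_def)
  with assms(1) show ?thesis by (meson rtrancl.rtrancl_into_rtrancl)
qed

text \<open>
  The geodesic from \<open>v\<close> into the class of \<open>w\<close> starts with an arrow into that class. Follow a zigzag
  through the class: since \<open>v\<close> itself is not in the class, the zigzag can pass through \<open>v\<close> only as
  a centre \<open>c\<close>, and then it leaves \<open>v\<close> along an arrow into the class. Its last such passage
  determines the first edge of the geodesic.
\<close>

lemma forward_first_step:
  assumes "(w, z) \<in> R"
  shows "\<exists>y. (v, y) \<in> arrow \<and> (w, y) \<in> R \<and> (y, z) \<in> (adj_off (edges X) v)\<^sup>*"
  using assms
proof (induction rule: R_induct)
  case base
  have "(w, w) \<in> R"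
    using w_vert invariant_equiv_equiv[OF R_invariant] by (auto simp: equiv_def refl_on_def)
  moreover have "(v, w) \<in> arrow"
    using act_one v_vert w_vert monoid.one_closed[OF group.is_monoid[OF is_group]]
    unfolding arrow_def by (metis (mono_tags, lifting) mem_Collect_eq)
  ultimately show ?case by blast
next
  case (step y z c)
  have "y \<noteq> v" "z \<noteq> v" using step(1,2) survives R_sym by blast+
  with step adj_off_extend show ?case by (cases "c = v") blast+
qed

lemma forward_first_step_translate:
  assumes h: "h \<in> carrier G" "(w, act X h w) \<in> R" "act X h v \<noteq> v"
  shows "\<exists>y. (v, y) \<in> arrow \<and> (w, y) \<in> R \<and> (y, act X h v) \<in> (adj_off (edges X) v)\<^sup>*"
proof -
  from forward_first_step[OF h(2)] obtain y where
    y: "(v, y) \<in> arrow" "(w, y) \<in> R" "(y, act X h w) \<in> (adj_off (edges X) v)\<^sup>*" by blast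
  have "act X h w \<noteq> v" using h(2) survives R_sym by blast
  moreover have "(act X h v, act X h w) \<in> arrow" using h by (auto simp: arrow_def)
  ultimately have "(act X h w, act X h v) \<in> adj_off (edges X) v"
    using h(3) arrow_adj by (auto simp: adj_off_def)
  with y show ?thesis by (meson rtrancl.rtrancl_into_rtrancl)
qed

text \<open>
  If \<open>t v \<noteq> v\<close>, the commuting element \<open>g\<close> fixes both ends of the geodesic from \<open>v\<close> to \<open>t v\<close>, hence
  its first edge, which is \<open>(v, k w)\<close> for some \<open>k\<close> fixing \<open>v\<close> and the class of \<open>w\<close>. Conjugating by \<open>k\<close>,
  with which \<open>g\<close> commutes too, shows \<open>g w = w\<close>, contrary to the assumption on \<open>g\<close>.
\<close>

lemma commuting_element_fixes_v:
  assumes t: "t \<in> carrier G" "(w, act X t w) \<in> R" "g \<otimes>\<^bsub>G\<^esub> t = t \<otimes>\<^bsub>G\<^esub> g"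
    and comm: "\<And>k. k \<in> carrier G \<Longrightarrow> act X k v = v \<Longrightarrow> (w, act X k w) \<in> R \<Longrightarrow>
      g \<otimes>\<^bsub>G\<^esub> k = k \<otimes>\<^bsub>G\<^esub> g"
  shows "act X t v = v"
proof (rule ccontr)
  assume "act X t v \<noteq> v"
  from forward_first_step_translate[OF t(1,2) this] obtain y where
    y: "(v, y) \<in> arrow" "(w, y) \<in> R" "(y, act X t v) \<in> (adj_off (edges X) v)\<^sup>*" by blast
  from y(1) obtain k where k: "k \<in> carrier G" "act X k v = v" "act X k w = y"
    by (auto simp: arrow_def)
  then have gk: "g \<otimes>\<^bsub>G\<^esub> k = k \<otimes>\<^bsub>G\<^esub> g" using comm y(2) by blast
  have "act X g (act X t v) = act X t v"
    using act_mult[OF g(1) t(1) v_vert] act_mult[OF t(1) g(1) v_vert] t(3) g(2) by simp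
  then have "(act X g y, act X t v) \<in> (adj_off (edges X) v)\<^sup>*"
    using act_adj_off[OF g(1) v_vert y(3)] g(2) by simp
  moreover have "(v, act X g y) \<in> adj (edges X)"
    using arrow_adj[OF y(1)] act_edge[OF g(1), of v y] g(2) by (simp add: adj_def)
  ultimately have "act X g y = y"
    using tree_first_step_unique[OF tree _ _ _ y(3)] arrow_adj[OF y(1)] by blast
  then have "act X k (act X g w) = act X k w"
    using k act_mult[OF g(1) k(1) w_vert] act_mult[OF k(1) g(1) w_vert] gk
    by simp
  then show False using act_inj[OF k(1)] act_closed[OF g(1)] w_vert g(3) by blast
qed

end

section \<open>Unfoldedness of generalized Baumslag--Solitar trees\<close>

lemma infinite_cyclic_commute:
  assumes "group G" "infinite_cyclic G H" "a \<in> H" "b \<in> H"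
  shows "a \<otimes>\<^bsub>G\<^esub> b = b \<otimes>\<^bsub>G\<^esub> a"
proof -
  have "comm_group (G\<lparr>carrier := H\<rparr>)"
    using assms(1,2) group.cyclic_imp_abelian_group subgroup.subgroup_is_group
    by (auto simp: infinite_cyclic_def)
  from comm_groupE(4)[OF this, of a b] show ?thesis using assms(3,4) by simp
qed

lemma collapse_not_folded:
  fixes G :: "('g, 'b) monoid_scheme" and X :: "('g, 'v) gtree" and S :: "('g, 'w) gtree"
  assumes gbs: "gbs_tree G X"
    and proper: "\<And>e v. e \<in> edges X \<Longrightarrow> v \<in> e \<Longrightarrow> edge_stab G X e \<subset> vertex_stab G X v"
    and e: "e \<in> edges X"
    and T: "is_splitting G (collapse G X e)"
    and S: "is_splitting G S"
  shows "\<not> nontrivial_fold G S (collapse G X e)"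
proof
  assume "nontrivial_fold G S (collapse G X e)"
  then obtain v w u where vw: "{v, w} \<in> edges S" and vu: "{v, u} \<in> edges S" and "w \<noteq> u"
    and iso: "gtree_iso G (quotient_gtree S (fold_rel G S w u)) (collapse G X e)"
    by (auto simp: nontrivial_fold_def)
  interpret X: group_tree G X using gbs by unfold_locales (simp add: gbs_tree_def)
  interpret S: group_tree G S using S by unfold_locales (simp add: is_splitting_def)
  interpret T: group_tree G "collapse G X e"
    using T by unfold_locales (simp add: is_splitting_def)
  define R where "R = fold_rel G S w u"
  define P where "P = X.component_rel e"
  let ?Q = "quotient_gtree S R" and ?T = "quotient_gtree X P"
  have TP: "collapse G X e = ?T" by (simp add: collapse_def P_def X.component_rel_def)
  have verts: "v \<in> verts S" "w \<in> verts S" "u \<in> verts S" using S.edge_verts vw vu by auto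
  have R: "S.invariant_equiv R" unfolding R_def using verts by (intro S.fold_rel_invariant)
  have P: "X.invariant_equiv P" unfolding P_def using e by (rule X.component_rel_invariant)
  obtain \<phi> where bij: "bij_betw \<phi> (verts ?Q) (verts ?T)"
    and edges: "edges ?T = (`) \<phi> ` edges ?Q"
    and equi: "\<And>g x. g \<in> carrier G \<Longrightarrow> x \<in> verts ?Q \<Longrightarrow> \<phi> (act ?Q g x) = act ?T g (\<phi> x)"
    using iso unfolding gtree_iso_def TP R_def[symmetric] by auto
  \<comment> \<open>The fold itself, as a map from the vertices of \<open>S\<close> to those of the collapse of \<open>X\<close>.\<close>
  define \<psi> where "\<psi> x = \<phi> (R `` {x})" for x
  have Q_vert: "R `` {x} \<in> verts ?Q" if "x \<in> verts S" for x
    using that by (simp add: quotient_gtree_def quotientI)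
  have \<psi>_act: "\<psi> (act S g x) = act ?T g (\<psi> x)" if "g \<in> carrier G" "x \<in> verts S" for g x
    using equi[OF that(1) Q_vert[OF that(2)]] S.quotient_act[OF R that] by (simp add: \<psi>_def)
  have \<psi>_eq: "\<psi> x = \<psi> y \<longleftrightarrow> (x, y) \<in> R" if "x \<in> verts S" "y \<in> verts S" for x y
    using bij Q_vert that S.class_eq_iff[OF R that]
    by (auto simp: \<psi>_def bij_betw_def dest: inj_onD)
  obtain a0 b0 where e0: "{a0, b0} \<in> edges S" "edges S = orbit G (edge_act S) {a0, b0}"
    using S unfolding is_splitting_def by blast
  note translate = S.orbit_edges_translate[OF e0(2,1) vw]
  \<comment> \<open>If one edge of \<open>S\<close> disappeared, so would its whole orbit, and the quotient would have no edge.\<close>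
  have vw_R: "(v, w) \<notin> R"
  proof
    assume *: "(v, w) \<in> R"
    have "(x, y) \<in> R" if "{x, y} \<in> edges S" for x y
    proof -
      from translate[OF that] obtain k where "k \<in> carrier G" "{x, y} = {act S k v, act S k w}" .
      then show ?thesis using S.invariant_equiv_act[OF R _ *] S.invariant_equiv_sym[OF R]
        by (metis doubleton_eq_iff)
    qed
    then have "edges ?Q = {}" by (auto simp: quotient_gtree_def)
    then have "edges ?T = {}" using edges by simp
    then show False using T unfolding is_splitting_def TP by blast
  qed
  then have "{R `` {v}, R `` {w}} \<in> edges ?Q" using vw by (auto simp: quotient_gtree_def)
  then have "\<phi> ` {R `` {v}, R `` {w}} \<in> edges ?T" unfolding edges by (rule imageI)
  then have \<psi>_edge: "{\<psi> v, \<psi> w} \<in> edges ?T" by (simp add: \<psi>_def)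
  obtain g where g: "g \<in> carrier G" "{v, u} = {act S g v, act S g w}"
    using translate[OF vu] .
  have wu: "(w, u) \<in> R" unfolding R_def using verts by (intro S.fold_rel_pair)
  \<comment> \<open>Either \<open>g\<close> preserves the orientation away from \<open>v\<close>, or the image of \<open>{v, w}\<close> is inverted.\<close>
  consider "act S g v = v" "act S g w = u" | "act S g v = u" "act S g w = v"
    using g(2) by (metis doubleton_eq_iff)
  then show False
  proof cases
    case 2
    have "act ?T g (\<psi> v) = \<psi> w" "act ?T g (\<psi> w) = \<psi> v"
      using 2 \<psi>_act[OF g(1)] \<psi>_eq wu verts by metis+
    then show False using T.no_inversion[OF g(1)] \<psi>_edge unfolding TP by blast
  next
    case 1
    interpret F: edge_fold G S v w g
      using vw g 1 \<open>w \<noteq> u\<close> vw_R by unfold_locales (auto simp: R_def)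
    have R_eq: "F.R = R" using 1 by (simp add: R_def)
    obtain x y where xy: "{x, y} \<in> edges X" "(x, y) \<notin> P" "\<psi> v = P `` {y}" "\<psi> w = P `` {x}"
    proof -
      from \<psi>_edge obtain x y where "{\<psi> v, \<psi> w} = {P `` {x}, P `` {y}}" "{x, y} \<in> edges X"
        "(x, y) \<notin> P" by (auto simp: quotient_gtree_def)
      moreover have "(y, x) \<notin> P" using calculation(3) X.invariant_equiv_sym[OF P] by blast
      ultimately show thesis using that[of x y] that[of y x]
        by (auto simp: doubleton_eq_iff insert_commute)
    qed
    have xyV: "x \<in> verts X" "y \<in> verts X" using X.edge_verts[OF xy(1)] by auto
    \<comment> \<open>The map \<open>\<psi>\<close> is equivariant, so the stabilizers of the classes in \<open>S\<close> can be read off in \<open>X\<close>.\<close>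
    have moved: "(a, act S h a) \<in> R \<longleftrightarrow> (b, act X h b) \<in> P"
      if "h \<in> carrier G" "a \<in> verts S" "b \<in> verts X" "\<psi> a = P `` {b}" for h a b
      using that \<psi>_act[OF that(1,2)] \<psi>_eq[OF that(2) S.act_closed[OF that(1,2)]]
        X.quotient_act[OF P that(1,3)] X.class_eq_iff[OF P that(3) X.act_closed[OF that(1,3)]]
      by metis
    have stab: "h \<in> edge_stab G X {x, y}"
      if "h \<in> carrier G" "act S h v = v" "(w, act S h w) \<in> R" for h
    proof (rule X.component_stab_le_edge_stab[OF e xy(1)])
      have "(v, act S h v) \<in> R" using that(2) \<psi>_eq[of v v] verts by simp
      then show "(y, act X h y) \<in> X.component_rel e"
        using moved[OF that(1) verts(1) xyV(2) xy(3)] by (simp add: P_def)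
      show "(x, act X h x) \<in> X.component_rel e"
        using moved[OF that(1) verts(2) xyV(1) xy(4)] that(3) by (simp add: P_def)
    qed (use that xy(2) in \<open>auto simp: P_def\<close>)
    have sub: "edge_stab G X {x, y} \<subset> vertex_stab G X x" using proper xy(1) by blast
    then obtain t where t: "t \<in> vertex_stab G X x" "t \<notin> edge_stab G X {x, y}" by blast
    have cyc: "infinite_cyclic G (vertex_stab G X x)" using gbs xyV by (simp add: gbs_tree_def)
    have tG: "t \<in> carrier G" "act X t x = x"
      using t by (auto simp: vertex_stab_def stabilizer_def)
    have "(x, act X t x) \<in> P"
      using tG xyV X.invariant_equiv_equiv[OF P] by (auto simp: equiv_def refl_on_def)
    then have wt: "(w, act S t w) \<in> R" using moved[OF tG(1) verts(2) xyV(1) xy(4)] by simp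
    have g_stab: "g \<in> edge_stab G X {x, y}" using stab[OF g(1)] 1 wu by simp
    have comm: "g \<otimes>\<^bsub>G\<^esub> h = h \<otimes>\<^bsub>G\<^esub> g" if "h \<in> vertex_stab G X x" for h
      using infinite_cyclic_commute[OF X.is_group cyc _ that] g_stab sub by blast
    \<comment> \<open>As the class of \<open>v\<close> moves under \<open>t\<close>, this equation is the contradiction.\<close>
    have "act S t v = v"
    proof (rule F.commuting_element_fixes_v)
      show "g \<otimes>\<^bsub>G\<^esub> h = h \<otimes>\<^bsub>G\<^esub> g"
        if "h \<in> carrier G" "act S h v = v" "(w, act S h w) \<in> F.R" for h
        using that stab[of h] sub comm R_eq by blast
    qed (use tG wt R_eq comm t in auto)
    then show False using stab[OF tG(1) _ wt] t(2) by blast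
  qed
qed

theorem proposition2p17:
  fixes G :: "('g, 'b) monoid_scheme" and X :: "('g, 'v) gtree"
  assumes "gbs_tree G X"
    and "cocompact G X"
    and "\<And>e v. e \<in> edges X \<Longrightarrow> v \<in> e \<Longrightarrow> edge_stab G X e \<subset> vertex_stab G X v"
  shows "unfolded TYPE('w) G X"
  using collapse_not_folded[OF assms(1,3)]
  by (auto simp: unfolded_def unfolded_splitting_def)

end
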